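(* Let $F$ be a finite nonempty connected linear $s$-uniform hypergraph whose line graph is a cograph. Suppose $R_s(F)=d$ with $0<d\le s-1$ and that $\operatorname{Comp}(s,d)$ holds. Suppose further that there are an affine plane $\Pi$ of order $s$ and an integer $h$, $1\le h\le d$, such that $F\subseteq\Pi$, $F$ contains every line in $s+1-h$ parallel classes of $\Pi$ (the full parallel classes), and $F$ contains exactly $d-h$ additional lines from the remaining $h$ classes (the partial-direction lines). Then $$|V(F)|=s^2,\qquad \operatorname{rank}N(F)=1+(s+1-h)(s-1)+(d-h),\qquad C(F)=hs-d,$$ and $$(s+1)|V(F)|-s|E(F)|=s\bigl((s+1)h-d\bigr).$$ Every partial-direction row has leverage $1$, while every row in a full parallel class has leverage $$1-\frac{s-h}{s(s+1-h)}.$$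
   Context: A hypergraph is $s$-uniform if every edge has exactly $s$ vertices, and linear if any two distinct edges share at most one vertex. The line graph has the edges of the hypergraph as vertices, two distinct edges being adjacent when they intersect. A cograph is a graph with no induced path on four vertices. Connected hypergraphs have connected line graph and no isolated vertices. $N(F)$ is the edge--vertex incidence matrix (rows indexed by edges; isolated vertices removed); ranks are over $\mathbb R$. Define $$R_s(F)=(s+1)\operatorname{rank}N(F)-s|E(F)|,\qquad C(F)=|V^+(F)|-\operatorname{rank}N(F),$$ where $V^+(F)$ is the set of nonisolated vertices. The row leverage of $e\in E(F)$ is $\ell_F(e)=(P_F)_{ee}$, where $P_F=N(F)N(F)^\dagger$ is the orthogonal projector of $\mathbb R^{E(F)}$ onto the column space of $N(F)$. An $a$-net of order $s$ is a linear $s$-uniform incidence structure on $s^2$ points whose lines are divided into $a$ parallel classes; each class consists of $s$ disjoint lines partitioning the point set, and lines from different classes meet in exactly one point. Its deficiency is $s+1-a$. An affine plane of order $s$ is an $(s+1)$-net of order $s$. $F\subseteq\Pi$ means that every edge of $F$ is a line of $\Pi$. Completion hypothesis: for $0\le d\le s-1$, $\operatorname{Comp}(s,d)$ means that (i) every net of order $s$ and deficiency at most $d$ embeds in an affine plane of order $s$ (on the same point set, its parallel classes being parallel classes of the plane), and (ii) $s>(d-1)^2$. *)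

theory Defs
  imports
    "Jordan_Normal_Form.DL_Rank"
    "Graph_Theory.Digraph_Component"
    "HOL-Library.Disjoint_Sets"
begin

section \<open>Hypergraphs\<close>

record 'a hypergraph =
  hverts :: "'a set"
  hedges :: "'a set set"

definition finite_hypergraph :: "'a hypergraph \<Rightarrow> bool" where
  "finite_hypergraph F \<longleftrightarrow> finite (hverts F) \<and> (\<forall>e\<in>hedges F. e \<subseteq> hverts F)"

definition uniform :: "nat \<Rightarrow> 'a hypergraph \<Rightarrow> bool" where
  "uniform s F \<longleftrightarrow> (\<forall>e\<in>hedges F. card e = s)"

definition linear_hypergraph :: "'a hypergraph \<Rightarrow> bool" where
  "linear_hypergraph F \<longleftrightarrow> (\<forall>e\<in>hedges F. \<forall>f\<in>hedges F. e \<noteq> f \<longrightarrow> card (e \<inter> f) \<le> 1)"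

definition nonisolated :: "'a hypergraph \<Rightarrow> 'a set" where
  "nonisolated F = {v \<in> hverts F. \<exists>e\<in>hedges F. v \<in> e}"

text \<open>Undirected simple graphs are represented as loop-free symmetric digraphs.\<close>

definition line_graph :: "'a hypergraph \<Rightarrow> 'a set pair_pre_digraph" where
  "line_graph F = \<lparr> pverts = hedges F,
     parcs = {(e, f). e \<in> hedges F \<and> f \<in> hedges F \<and> e \<noteq> f \<and> e \<inter> f \<noteq> {}} \<rparr>"

definition cograph :: "'b pair_pre_digraph \<Rightarrow> bool" where
  "cograph G \<longleftrightarrow> \<not> (\<exists>a\<in>pverts G. \<exists>b\<in>pverts G. \<exists>c\<in>pverts G. \<exists>d\<in>pverts G.
     distinct [a, b, c, d] \<and>
     (a, b) \<in> parcs G \<and> (b, c) \<in> parcs G \<and> (c, d) \<in> parcs G \<and>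
     (a, c) \<notin> parcs G \<and> (a, d) \<notin> parcs G \<and> (b, d) \<notin> parcs G)"

definition connected_hypergraph :: "'a hypergraph \<Rightarrow> bool" where
  "connected_hypergraph F \<longleftrightarrow>
     Digraph_Component.connected (with_proj (line_graph F)) \<and> nonisolated F = hverts F"


section \<open>Incidence matrix, rank and leverage\<close>

text \<open>
  Matrices are indexed by initial segments of the natural numbers, so edges and nonisolated
  vertices are numbered by an arbitrary but fixed enumeration.  The rank and the leverages
  do not depend on this choice.
\<close>

definition enumerate_set :: "'b set \<Rightarrow> nat \<Rightarrow> 'b" where
  "enumerate_set A = (SOME f. bij_betw f {..<card A} A)"

definition index_in :: "'b set \<Rightarrow> 'b \<Rightarrow> nat" where
  "index_in A = inv_into {..<card A} (enumerate_set A)"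

definition incidence_mat :: "'a hypergraph \<Rightarrow> real mat" where
  "incidence_mat F = mat (card (hedges F)) (card (nonisolated F))
     (\<lambda>(i, j). if enumerate_set (nonisolated F) j \<in> enumerate_set (hedges F) i then 1 else 0)"

definition mat_rank :: "real mat \<Rightarrow> nat" where
  "mat_rank A = vec_space.rank (dim_row A) A"

text \<open>The Moore--Penrose inverse, characterised by the four Penrose equations.\<close>

definition is_pseudoinverse :: "real mat \<Rightarrow> real mat \<Rightarrow> bool" where
  "is_pseudoinverse A X \<longleftrightarrow> X \<in> carrier_mat (dim_col A) (dim_row A) \<and>
     A * X * A = A \<and> X * A * X = X \<and>
     transpose_mat (A * X) = A * X \<and> transpose_mat (X * A) = X * A"

definition pseudoinverse :: "real mat \<Rightarrow> real mat" where
  "pseudoinverse A = (THE X. is_pseudoinverse A X)"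

definition row_projector :: "'a hypergraph \<Rightarrow> real mat" where
  "row_projector F = incidence_mat F * pseudoinverse (incidence_mat F)"

definition leverage :: "'a hypergraph \<Rightarrow> 'a set \<Rightarrow> real" where
  "leverage F e = row_projector F $$ (index_in (hedges F) e, index_in (hedges F) e)"

definition R_inv :: "nat \<Rightarrow> 'a hypergraph \<Rightarrow> int" where
  "R_inv s F = (int s + 1) * int (mat_rank (incidence_mat F)) - int s * int (card (hedges F))"

definition C_inv :: "'a hypergraph \<Rightarrow> int" where
  "C_inv F = int (card (nonisolated F)) - int (mat_rank (incidence_mat F))"


section \<open>Nets and affine planes\<close>

text \<open>
  A net is given by its point set \<open>P\<close> and its set \<open>\<C>\<close> of parallel classes;
  its lines are the members of \<open>\<Union>\<C>\<close>.
\<close>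

definition net :: "nat \<Rightarrow> nat \<Rightarrow> 'a set \<Rightarrow> 'a set set set \<Rightarrow> bool" where
  "net s a P \<C> \<longleftrightarrow>
     finite_hypergraph \<lparr> hverts = P, hedges = \<Union>\<C> \<rparr> \<and>
     uniform s \<lparr> hverts = P, hedges = \<Union>\<C> \<rparr> \<and>
     linear_hypergraph \<lparr> hverts = P, hedges = \<Union>\<C> \<rparr> \<and>
     card P = s ^ 2 \<and>
     finite \<C> \<and> card \<C> = a \<and> disjoint \<C> \<and>
     (\<forall>c\<in>\<C>. card c = s \<and> partition_on P c) \<and>
     (\<forall>c\<in>\<C>. \<forall>c'\<in>\<C>. c \<noteq> c' \<longrightarrow> (\<forall>l\<in>c. \<forall>m\<in>c'. card (l \<inter> m) = 1))"

definition deficiency :: "nat \<Rightarrow> nat \<Rightarrow> int" where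
  "deficiency s a = int s + 1 - int a"

definition affine_plane :: "nat \<Rightarrow> 'a set \<Rightarrow> 'a set set set \<Rightarrow> bool" where
  "affine_plane s P \<C> \<longleftrightarrow> net s (s + 1) P \<C>"

text \<open>
  The completion hypothesis is a property of the numbers \<open>s\<close> and \<open>d\<close> alone.
  Since every finite net is isomorphic to one whose points are natural numbers, it suffices to
  quantify over nets on that type.  The second part is stated over the integers because of the
  subtraction.
\<close>

definition Comp :: "nat \<Rightarrow> nat \<Rightarrow> bool" where
  "Comp s d \<longleftrightarrow>
     (\<forall>a (P :: nat set) \<C>. net s a P \<C> \<and> deficiency s a \<le> int d \<longrightarrow>
        (\<exists>\<C>'. affine_plane s P \<C>' \<and> \<C> \<subseteq> \<C>')) \<and>
     int s > (int d - 1) ^ 2"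

end

theory Submission
  imports Defs
begin

text \<open>
  The rank is read off from \<open>R_inv s F = d\<close> and the edge count
  \<open>a * s + (d - h)\<close>, where \<open>a = s + 1 - h\<close> is the number of full
  classes. Hence the left kernel of the incidence matrix has dimension \<open>a - 1\<close>. The vectors
  that vanish on partial-direction lines, are constant on each full class and have
  coordinate sum zero form an \<open>(a - 1)\<close>-dimensional subspace of that kernel, because every
  point lies on exactly one line of each full class; so they exhaust it. The projector onto them is
  explicit, and the row projector is its complement.

  The dimension count is done with traces: if \<open>P\<close> is the row projector and \<open>Q\<close> the explicit
  one, then \<open>1 - P - Q\<close> is a symmetric idempotent of trace zero, and a symmetric idempotent
  \<open>D\<close> has \<open>trace D\<close> equal to the sum of its squared entries.
\<close>

section \<open>Generalized inverses, trace and rank\<close>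

text \<open>Induction on the number of nonzero rows. One pivot step produces
  \<open>B = L * A = A * K\<close> with fewer nonzero rows. If \<open>B * H * B = B\<close>, then
  \<open>A * (K * H * L) * A\<close> equals \<open>B\<close>, so \<open>D + K * H * L\<close>
  restores the subtracted \<open>A * D * A\<close> and serves for \<open>A\<close>.\<close>

lemma ex_generalized_inverse:
  fixes A :: "'a::field mat"
  assumes "A \<in> carrier_mat n m"
  shows "\<exists>G \<in> carrier_mat m n. A * G * A = A"
  using assms
proof (induction "card {p. p < n \<and> row A p \<noteq> 0\<^sub>v m}" arbitrary: A rule: less_induct)
  case less
  note A = less.prems
  show ?case
  proof (cases "A = 0\<^sub>m n m")
    case True
    then show ?thesis by (intro bexI[of _ "0\<^sub>m m n"]) auto
  next
    case False
    then obtain i j where ij: "i < n" "j < m" "A $$ (i, j) \<noteq> 0"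
      using A by (metis carrier_matD eq_matI index_zero_mat)
    \<comment> \<open>Eliminate the pivot: \<open>A - A * D * A\<close> subtracts a rank-one matrix and clears row \<open>i\<close>.\<close>
    define a where "a = A $$ (i, j)"
    define D where "D = mat m n (\<lambda>(p, q). if p = j \<and> q = i then 1 / a else 0)"
    define B where "B = A - A * D * A"
    have D: "D \<in> carrier_mat m n" and B: "B \<in> carrier_mat n m"
      using A by (auto simp: D_def B_def)
    have AD: "(A * D) $$ (p, q) = (if q = i then A $$ (p, j) / a else 0)" if "p < n" "q < n" for p q
      using that A ij by (simp add: D_def scalar_prod_def if_distrib sum.If_cases cong: if_cong)
    have ADA: "(A * D * A) $$ (p, q) = A $$ (p, j) * A $$ (i, q) / a" if "p < n" "q < m" for p q
    proof -
      have "(A * D * A) $$ (p, q) = (\<Sum>k\<in>{0..<n}. (A * D) $$ (p, k) * A $$ (k, q))"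
        using that A D by (simp add: scalar_prod_def del: assoc_mult_mat)
      also have "\<dots> = (\<Sum>k\<in>{0..<n}. if k = i then A $$ (p, j) / a * A $$ (i, q) else 0)"
        using that AD by (intro sum.cong) auto
      finally show ?thesis using ij by simp
    qed
    have Bpq: "B $$ (p, q) = A $$ (p, q) - A $$ (p, j) * A $$ (i, q) / a" if "p < n" "q < m" for p q
      unfolding B_def by (subst index_minus_mat) (use that A D ADA in auto)
    have rowB: "row B p = 0\<^sub>v m" if "p < n" "row A p = 0\<^sub>v m" for p
    proof -
      have "A $$ (p, q) = 0" if "q < m" for q
        using arg_cong[OF \<open>row A p = 0\<^sub>v m\<close>, of "\<lambda>v. v $ q"] that \<open>p < n\<close> A by simp
      then show ?thesis using Bpq that B ij by (intro eq_vecI) auto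
    qed
    have "row B i = 0\<^sub>v m"
      using Bpq B ij by (intro eq_vecI) (auto simp: a_def)
    moreover have "row A i \<noteq> 0\<^sub>v m"
      using ij A by (metis carrier_matD index_row(1) index_zero_vec(1))
    ultimately have "{p. p < n \<and> row B p \<noteq> 0\<^sub>v m} \<subset> {p. p < n \<and> row A p \<noteq> 0\<^sub>v m}"
      using rowB ij by blast
    then have "card {p. p < n \<and> row B p \<noteq> 0\<^sub>v m} < card {p. p < n \<and> row A p \<noteq> 0\<^sub>v m}"
      by (intro psubset_card_mono) auto
    from less.hyps[OF this B] obtain H where H: "H \<in> carrier_mat m n" "B * H * B = B" by blast
    define L where "L = 1\<^sub>m n - A * D"
    define K where "K = 1\<^sub>m m - D * A"
    have L: "L \<in> carrier_mat n n" and K: "K \<in> carrier_mat m m"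
      using A D by (auto simp: L_def K_def)
    have BL: "B = L * A" and BK: "B = A * K"
      using A D by (simp_all add: B_def L_def K_def minus_mult_distrib_mat[of _ n n _ _ m]
          mult_minus_distrib_mat[of _ n m _ m] assoc_mult_mat[of _ n m _ n _ m])
    let ?G = "D + K * H * L"
    have "A * ?G * A = A * D * A + A * (K * H * L) * A"
      using A D K H(1) L by (simp add: mult_add_distrib_mat[of _ n m _ n] add_mult_distrib_mat[of _ n n _ _ m])
    also have "A * (K * H * L) * A = (A * K) * H * (L * A)"
      using A K H(1) L by (simp add: assoc_mult_mat[of _ n m _ m _ n] assoc_mult_mat[of _ n n _ n _ m]
        assoc_mult_mat[of _ m m _ n _ n] assoc_mult_mat[of _ n m _ n _ n] assoc_mult_mat[of _ n m _ n _ m]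
        assoc_mult_mat[of _ n m _ m _ m] assoc_mult_mat[of _ m m _ n _ m] assoc_mult_mat[of _ m n _ n _ m])
    also have "\<dots> = B"
      using H BL BK by simp
    also have "A * D * A + B = A"
      unfolding B_def by (rule eq_matI) (use A D in auto)
    finally show ?thesis
      using A D K H(1) L by (intro bexI[of _ ?G]) auto
  qed
qed

section \<open>Trace and the Frobenius norm\<close>

definition mat_trace :: "'a::semiring_1 mat \<Rightarrow> 'a" where
  "mat_trace A = (\<Sum>i<dim_row A. A $$ (i, i))"

lemma mat_trace_mult_comm:
  fixes A B :: "'a::comm_semiring_1 mat"
  assumes "A \<in> carrier_mat n m" "B \<in> carrier_mat m n"
  shows "mat_trace (A * B) = mat_trace (B * A)"
proof -
  have "mat_trace (A * B) = (\<Sum>i<n. \<Sum>j<m. A $$ (i, j) * B $$ (j, i))"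
    using assms by (auto simp: mat_trace_def scalar_prod_def atLeast0LessThan intro!: sum.cong)
  also have "\<dots> = (\<Sum>j<m. \<Sum>i<n. B $$ (j, i) * A $$ (i, j))"
    by (subst sum.swap) (simp add: mult.commute)
  also have "\<dots> = mat_trace (B * A)"
    using assms by (auto simp: mat_trace_def scalar_prod_def atLeast0LessThan intro!: sum.cong)
  finally show ?thesis .
qed

lemma transpose_mult_self_trace:
  fixes A :: "real mat"
  assumes "A \<in> carrier_mat n m"
  shows "mat_trace (A\<^sup>T * A) = (\<Sum>j<m. \<Sum>i<n. (A $$ (i, j))\<^sup>2)"
  using assms by (auto simp: mat_trace_def scalar_prod_def atLeast0LessThan power2_eq_square intro!: sum.cong)

text \<open>The trace is the squared Frobenius norm of \<open>A\<close>, a sum of squares; over the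
  reals it vanishes only if every entry does.\<close>

lemma mat_eq_0_if_trace_eq_0:
  fixes A :: "real mat"
  assumes A: "A \<in> carrier_mat n m" and "mat_trace (A\<^sup>T * A) = 0"
  shows "A = 0\<^sub>m n m"
proof (rule eq_matI)
  fix i j assume "i < dim_row (0\<^sub>m n m :: real mat)" "j < dim_col (0\<^sub>m n m :: real mat)"
  moreover have "(\<Sum>j<m. \<Sum>i<n. (A $$ (i, j))\<^sup>2) = 0"
    using assms transpose_mult_self_trace by metis
  then have "\<forall>j<m. \<forall>i<n. A $$ (i, j) = 0"
    by (simp add: sum_nonneg_eq_0_iff sum_nonneg)
  ultimately show "A $$ (i, j) = 0\<^sub>m n m $$ (i, j)" by simp
qed (use A in auto)

lemma transpose_mult_self_eq_0:
  fixes A :: "real mat"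
  assumes A: "A \<in> carrier_mat n m" and "A\<^sup>T * A = 0\<^sub>m m m"
  shows "A = 0\<^sub>m n m"
  using A by (rule mat_eq_0_if_trace_eq_0) (simp add: assms mat_trace_def)

text \<open>
  With \<open>G\<close> a generalized inverse of \<open>A\<^sup>T * A\<close>, the matrix \<open>G\<^sup>T * A\<^sup>T\<close> works.
\<close>
lemma ex_least_squares_inverse:
  fixes A :: "real mat"
  assumes A: "A \<in> carrier_mat n m"
  shows "\<exists>Y \<in> carrier_mat m n. A * Y * A = A \<and> (A * Y)\<^sup>T = A * Y"
proof -
  define M where "M = A\<^sup>T * A"
  have At: "A\<^sup>T \<in> carrier_mat m n" and M: "M \<in> carrier_mat m m"
    using A by (auto simp: M_def)
  obtain G where G: "G \<in> carrier_mat m m" "M * G * M = M"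
    using ex_generalized_inverse[OF M] by blast
  \<comment> \<open>\<open>D\<close> is orthogonal to the columns of \<open>A\<close> because
    \<open>M * G * M = M\<close>, and its own columns lie in their span. Hence
    \<open>D\<^sup>T * D\<close> vanishes, and so does \<open>D\<close>.\<close>
  define D where "D = A * (G * M) - A"
  have D: "D \<in> carrier_mat n m"
    using A G M by (auto simp: D_def)
  have AtD: "A\<^sup>T * D = 0\<^sub>m m m"
  proof -
    have "A\<^sup>T * D = A\<^sup>T * (A * (G * M)) - A\<^sup>T * A"
      unfolding D_def using A G M by (intro mult_minus_distrib_mat[of _ m n]) auto
    also have "A\<^sup>T * (A * (G * M)) = M * (G * M)"
      unfolding M_def using A At G(1) by (intro assoc_mult_mat[symmetric]) auto
    also have "\<dots> = M"
      using G M by simp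
    finally show ?thesis using M by (simp add: M_def)
  qed
  have D_eq: "D = A * (G * M - 1\<^sub>m m)"
    using A G(1) M by (simp add: D_def mult_minus_distrib_mat[of _ n m _ m])
  have Dt: "D\<^sup>T = (G * M - 1\<^sub>m m)\<^sup>T * A\<^sup>T"
    unfolding D_eq using A G(1) M by (intro transpose_mult) auto
  have "D\<^sup>T * D = (G * M - 1\<^sub>m m)\<^sup>T * (A\<^sup>T * D)"
    unfolding Dt using At D G(1) M by (intro assoc_mult_mat) auto
  also have "\<dots> = 0\<^sub>m m m"
    using AtD G(1) M by simp
  finally have "D = 0\<^sub>m n m"
    using D transpose_mult_self_eq_0 by blast
  have eq: "A * (G * M) = A"
  proof (rule eq_matI)
    fix i j assume "i < dim_row A" "j < dim_col A"
    then show "(A * (G * M)) $$ (i, j) = A $$ (i, j)"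
      using arg_cong[OF \<open>D = 0\<^sub>m n m\<close>, of "\<lambda>X. X $$ (i, j)"] A G(1) M by (simp add: D_def)
  qed (use A G(1) M in auto)
  define Y where "Y = G\<^sup>T * A\<^sup>T"
  have Y: "Y \<in> carrier_mat m n" using G(1) A by (auto simp: Y_def)
  \<comment> \<open>Transposing \<open>eq\<close> and using the symmetry of \<open>M\<close> gives
    the normal equations for \<open>Y\<close>.\<close>
  have "A\<^sup>T = (A * (G * M))\<^sup>T" using eq by simp
  also have "\<dots> = M\<^sup>T * G\<^sup>T * A\<^sup>T"
    using A G(1) M by (simp add: transpose_mult[of _ n m _ m] transpose_mult[of _ m m _ m])
  also have "M\<^sup>T = M"
    using A by (simp add: M_def transpose_mult[of _ m n _ m])
  also have "M * G\<^sup>T * A\<^sup>T = M * Y"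
    unfolding Y_def using At G(1) M by (intro assoc_mult_mat) auto
  also have "\<dots> = A\<^sup>T * (A * Y)"
    unfolding M_def using A At Y by (intro assoc_mult_mat) auto
  finally have normal: "A\<^sup>T * (A * Y) = A\<^sup>T" by simp
  have AY: "A * Y \<in> carrier_mat n n" using A Y by auto
  \<comment> \<open>The left side is symmetric whatever \<open>A * Y\<close> is, so the equation
    forces \<open>A * Y\<close> to be symmetric.\<close>
  have "(A * Y)\<^sup>T * (A * Y) = (A * Y)\<^sup>T"
    using A At Y AY normal by (simp add: transpose_mult[of _ n m _ n] del: assoc_mult_mat)
      (simp add: assoc_mult_mat[of "Y\<^sup>T" n m _ n _ n] normal del: assoc_mult_mat)
  then have sym: "(A * Y)\<^sup>T = A * Y"
    using AY by (metis transpose_mult transpose_carrier_mat transpose_transpose)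
  have "A = (A\<^sup>T * (A * Y))\<^sup>T"
    using normal by simp
  also have "\<dots> = A * Y * A"
    using At AY sym by (subst transpose_mult[of _ m n _ n]) auto
  finally have "A * Y * A = A" by (rule HOL.sym)
  then show ?thesis using Y sym by blast
qed

section \<open>The Moore-Penrose inverse\<close>

text \<open>\<open>A * X\<close> and \<open>A * Y\<close> are symmetric idempotents with the same
  range, hence equal; likewise \<open>X * A = Y * A\<close>. Then \<open>X = X * A * X\<close> can
  be rewritten to \<open>Y * A * Y = Y\<close>.\<close>

lemma is_pseudoinverse_unique:
  assumes "is_pseudoinverse A X" "is_pseudoinverse A Y"
  shows "X = Y"
proof -
  define n m where "n = dim_row A" and "m = dim_col A"
  have A: "A \<in> carrier_mat n m" by (simp add: n_def m_def)
  have X: "X \<in> carrier_mat m n" "A * X * A = A" "X * A * X = X" "(A * X)\<^sup>T = A * X" "(X * A)\<^sup>T = X * A"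
    and Y: "Y \<in> carrier_mat m n" "A * Y * A = A" "Y * A * Y = Y" "(A * Y)\<^sup>T = A * Y" "(Y * A)\<^sup>T = Y * A"
    using assms by (auto simp: is_pseudoinverse_def n_def m_def)
  have AXY: "A * X = A * Y"
  proof -
    have "A * X = (A * X)\<^sup>T" using X by simp
    also have "\<dots> = (A * Y * (A * X))\<^sup>T"
      using assoc_mult_mat[of "A * Y" n n A m X n] A X(1) Y(1,2) by (simp del: assoc_mult_mat)
    also have "\<dots> = A * X * (A * Y)"
      using A X(1,4) Y(1,4) by (subst transpose_mult[of _ n n _ n]) auto
    also have "\<dots> = A * Y"
      using assoc_mult_mat[of "A * X" n n A m Y n] A X(1,2) Y(1) by (simp del: assoc_mult_mat)
    finally show ?thesis .
  qed
  have XAY: "X * A = Y * A"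
  proof -
    have "X * A = (X * A)\<^sup>T" using X by simp
    also have "\<dots> = (X * A * (Y * A))\<^sup>T"
      using assoc_mult_mat[of X m n "A * Y" n A m] assoc_mult_mat[of X m n A m "Y * A" m]
        assoc_mult_mat[of A n m Y n A m] A X(1) Y(1,2) by (simp del: assoc_mult_mat)
    also have "\<dots> = Y * A * (X * A)"
      using A X(1,5) Y(1,5) by (subst transpose_mult[of _ m m _ m]) auto
    also have "\<dots> = Y * A"
      using assoc_mult_mat[of Y m n "A * X" n A m] assoc_mult_mat[of Y m n A m "X * A" m]
        assoc_mult_mat[of A n m X n A m] A X(1,2) Y(1) by (simp del: assoc_mult_mat)
    finally show ?thesis .
  qed
  have "X = Y * A * X" using X(3) XAY by simp
  also have "\<dots> = Y * (A * Y)" using A X(1) Y(1) AXY by simp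
  also have "\<dots> = Y" using A Y(1,3) by simp
  finally show ?thesis .
qed

text \<open>\<open>Y\<close> makes \<open>A * Y\<close> symmetric, and the same construction for the
  transpose yields \<open>H\<close> with \<open>H * A\<close> symmetric. The product
  \<open>H * A * Y\<close> inherits both symmetries.\<close>

lemma ex_pseudoinverse: "\<exists>X. is_pseudoinverse A X"
proof -
  define n m where "n = dim_row A" and "m = dim_col A"
  have A: "A \<in> carrier_mat n m" by (simp add: n_def m_def)
  obtain Y where Y: "Y \<in> carrier_mat m n" "A * Y * A = A" "(A * Y)\<^sup>T = A * Y"
    using ex_least_squares_inverse[OF A] by blast
  obtain Z where Z: "Z \<in> carrier_mat n m" "A\<^sup>T * Z * A\<^sup>T = A\<^sup>T" "(A\<^sup>T * Z)\<^sup>T = A\<^sup>T * Z"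
    using ex_least_squares_inverse[of "A\<^sup>T" m n] A by auto
  define H where "H = Z\<^sup>T"
  have H: "H \<in> carrier_mat m n" using Z by (simp add: H_def)
  have HA: "H * A = A\<^sup>T * Z"
    using A Z(1) Z(3) by (simp add: H_def transpose_mult[of _ m n _ m])
  have AHA: "A * H * A = A"
  proof -
    have "A = (A\<^sup>T * Z * A\<^sup>T)\<^sup>T" using Z(2) by simp
    also have "\<dots> = A * (H * A)"
      using A Z(1,3) HA by (subst transpose_mult[of _ m m _ n]) auto
    finally show ?thesis using A H by simp
  qed
  define X where "X = H * A * Y"
  have X: "X \<in> carrier_mat m n" using A H Y by (auto simp: X_def)
  have AX: "A * X = A * Y"
  proof -
    have "A * X = A * (H * A) * Y"
      unfolding X_def using A H Y(1) by (intro assoc_mult_mat[symmetric]) auto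
    then show ?thesis using AHA A H by simp
  qed
  have XA: "X * A = H * A"
  proof -
    have "X * A = H * (A * Y) * A"
      using A H Y(1) by (simp add: X_def)
    also have "\<dots> = H * (A * Y * A)"
      using A H Y(1) by (intro assoc_mult_mat) auto
    finally show ?thesis using Y by simp
  qed
  have "X * A * X = H * (A * X)"
    unfolding XA using A H X by simp
  then have "X * A * X = X"
    using A H Y(1) unfolding AX by (simp add: X_def)
  then have "is_pseudoinverse A X"
    using X AX XA Y Z(3) HA by (simp add: is_pseudoinverse_def n_def m_def)
  then show ?thesis ..
qed

lemma is_pseudoinverse_pseudoinverse: "is_pseudoinverse A (pseudoinverse A)"
  unfolding pseudoinverse_def
  by (rule theI') (use ex_pseudoinverse is_pseudoinverse_unique in blast)

section \<open>Rank factorization and the trace of an idempotent\<close>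

text \<open>The columns of \<open>B\<close> form a maximal independent set of columns of
  \<open>A\<close>, and \<open>C\<close> holds the coordinates of all columns in this basis.
  Choosing actual columns of \<open>A\<close> ensures that a matrix fixing the columns of
  \<open>A\<close> also fixes \<open>B\<close>.\<close>

lemma (in vec_space) rank_factorization:
  assumes A: "A \<in> carrier_mat n m"
  obtains B C where "B \<in> carrier_mat n (rank A)" "set (cols B) \<subseteq> set (cols A)"
    "C \<in> carrier_mat (rank A) m" "A = B * C"
    "\<forall>v \<in> carrier_vec (rank A). B *\<^sub>v v = 0\<^sub>v n \<longrightarrow> v = 0\<^sub>v (rank A)"
proof -
  have colsA: "set (cols A) \<subseteq> carrier_vec n" using A cols_dim by blast
  obtain S where S: "maximal S (\<lambda>T. T \<subseteq> set (cols A) \<and> lin_indpt T)"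
    using maximal_exists_superset[of "set (cols A)" "\<lambda>T. T \<subseteq> set (cols A) \<and> lin_indpt T" "{}"]
    by (metis List.finite_set empty_subsetI finite_lin_indpt2 finite.emptyI empty_iff)
  have rank: "rank A = card S" by (rule rank_card_indpt[OF A S])
  have S_sub: "S \<subseteq> set (cols A)" and S_li: "lin_indpt S" using S by (auto simp: maximal_def)
  have S_carrier: "S \<subseteq> carrier_vec n" and S_fin: "finite S"
    using S_sub colsA by (auto intro: finite_subset)
  obtain xs where xs: "set xs = S" "distinct xs" using S_fin finite_distinct_list by blast
  have len: "length xs = rank A" using xs rank distinct_card by metis
  define B where "B = mat_of_cols n xs"
  have B: "B \<in> carrier_mat n (rank A)" by (simp add: B_def len[symmetric])
  have colsB: "cols B = xs" using xs S_carrier by (simp add: B_def)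
  have inj: "v = 0\<^sub>v (rank A)" if "v \<in> carrier_vec (rank A)" "B *\<^sub>v v = 0\<^sub>v n" for v
    using lin_depI[OF B that(1) _ that(2)] colsB xs S_li by auto
  have "\<exists>w \<in> carrier_vec (rank A). col A j = B *\<^sub>v w" if "j < m" for j
  proof -
    have cA: "col A j \<in> set (cols A)" using that A by (metis carrier_matD(2) cols_length cols_nth nth_mem)
    \<comment> \<open>Otherwise \<open>S\<close> could be enlarged by this column, against
      maximality.\<close>
    have "col A j \<in> span S"
    proof (rule ccontr)
      assume notin: "col A j \<notin> span S"
      have "lin_indpt (insert (col A j) S)"
        using lin_dep_iff_in_span[of S "col A j"] S_carrier S_li cA colsA notin span_mem[of S "col A j"]
        by (metis Un_insert_right subsetD sup_bot_right)
      then show False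
        using S notin S_carrier cA S_sub span_mem unfolding maximal_def
        by (metis insert_subset insertI1 subset_insertI)
    qed
    then obtain a where "col A j = lincomb a S"
      using finite_in_span[OF S_fin, of "col A j"] S_carrier by metis
    also have "\<dots> = B *\<^sub>v vec (rank A) (\<lambda>i. a (col B i))"
      using mat_mult_eq_lincomb[OF B, of a] colsB xs by simp
    finally show ?thesis by (intro bexI) auto
  qed
  then obtain w where w: "\<And>j. j < m \<Longrightarrow> w j \<in> carrier_vec (rank A)" "\<And>j. j < m \<Longrightarrow> col A j = B *\<^sub>v w j"
    by metis
  define C where "C = mat (rank A) m (\<lambda>(i, j). w j $ i)"
  have C: "C \<in> carrier_mat (rank A) m" by (simp add: C_def)
  have "A = B * C"
  proof (rule mat_col_eqI)
    fix j assume "j < dim_col (B * C)"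
    then have j: "j < m" using C by simp
    then have "col C j = w j" using w(1)[OF j] by (intro eq_vecI) (auto simp: C_def)
    then show "col A j = col (B * C) j" using w(2)[OF j] by (simp only: col_mult2[OF B C j])
  qed (use A B C in auto)
  then show ?thesis using that B C inj colsB xs S_sub by blast
qed

text \<open>
  Let \<open>A = B * C\<close> be a rank factorization and \<open>H\<close> a left inverse of \<open>B\<close>. The idempotents
  \<open>A * X\<close> and \<open>B * H\<close> have the same range, so they have the same trace, which is that of
  \<open>H * B = 1\<close>.
\<close>
lemma (in vec_space) trace_idempotent_eq_rank:
  assumes A: "A \<in> carrier_mat n m" and X: "X \<in> carrier_mat m n" and AXA: "A * X * A = A"
  shows "mat_trace (A * X) = of_nat (rank A)"
proof -
  let ?r = "rank A"
  obtain B C where B: "B \<in> carrier_mat n ?r" and cols: "set (cols B) \<subseteq> set (cols A)"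
    and C: "C \<in> carrier_mat ?r m" and BC: "A = B * C"
    and inj: "\<forall>v \<in> carrier_vec ?r. B *\<^sub>v v = 0\<^sub>v n \<longrightarrow> v = 0\<^sub>v ?r"
    by (rule rank_factorization[OF A])
  define P where "P = A * X"
  have P: "P \<in> carrier_mat n n" using A X by (auto simp: P_def)
  have PB: "P * B = B"
  proof (rule mat_col_eqI)
    fix j assume "j < dim_col B"
    then have j: "j < ?r" using B by simp
    then have "col B j \<in> set (cols A)"
      using cols B by (metis carrier_matD(2) cols_length cols_nth nth_mem subsetD)
    then obtain k where k: "k < m" "col B j = col A k"
      using A by (metis carrier_matD(2) cols_length cols_nth in_set_conv_nth)
    have "P *\<^sub>v col A k = col (P * A) k" by (simp only: col_mult2[OF P A k(1)])
    also have "\<dots> = col A k" using AXA by (simp add: P_def)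
    finally show "col (P * B) j = col B j"
      by (simp only: col_mult2[OF P B j] k(2))
  qed (use P B in auto)
  obtain H where H: "H \<in> carrier_mat ?r n" "B * H * B = B"
    using ex_generalized_inverse[OF B] by blast
  have HB: "H * B = 1\<^sub>m ?r"
  proof (rule mat_col_eqI)
    fix j assume "j < dim_col (1\<^sub>m ?r :: 'a mat)"
    then have j: "j < ?r" by simp
    \<comment> \<open>\<open>B * H * B = B\<close> says that \<open>B\<close> kills this difference;
      the injectivity of \<open>B\<close> then makes it zero, so the generalized inverse
      \<open>H\<close> is a left inverse.\<close>
    let ?v = "col (H * B) j - unit_vec ?r j"
    have v: "?v \<in> carrier_vec ?r" using H B j by auto
    have "B *\<^sub>v ?v = B *\<^sub>v col (H * B) j - B *\<^sub>v unit_vec ?r j"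
      using B H j by (intro mult_minus_distrib_mat_vec[of _ n ?r]) auto
    also have "B *\<^sub>v col (H * B) j = col B j"
    proof -
      have "B *\<^sub>v col (H * B) j = col (B * (H * B)) j"
        using B H(1) j by (intro col_mult2[symmetric]) auto
      then show ?thesis using B H by simp
    qed
    also have "B *\<^sub>v unit_vec ?r j = col B j"
      using B j by (intro eq_vecI) (auto simp: scalar_prod_right_unit)
    finally have "B *\<^sub>v ?v = 0\<^sub>v n" using B j by auto
    then have "?v = 0\<^sub>v ?r" using inj v by blast
    then have "?v $ i = 0" if "i < ?r" for i using that by simp
    then have "col (H * B) j $ i = unit_vec ?r j $ i" if "i < ?r" for i
      using that H B j by auto
    then show "col (H * B) j = col (1\<^sub>m ?r) j"
      using H B j by (intro eq_vecI) auto
  qed (use H B in auto)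
  define P0 where "P0 = B * H"
  have P0: "P0 \<in> carrier_mat n n" using B H by (auto simp: P0_def)
  have "P * P0 = P0"
    using assoc_mult_mat[OF P B H(1)] PB by (simp add: P0_def del: assoc_mult_mat)
  have "P0 * A = P0 * B * C"
    unfolding BC using P0 B C by (intro assoc_mult_mat[symmetric]) auto
  then have "P0 * A = A" using H(2) BC by (simp add: P0_def)
  then have "P0 * P = P"
    using assoc_mult_mat[OF P0 A X] by (simp add: P_def del: assoc_mult_mat)
  then have "mat_trace P = mat_trace (P0 * P)" by simp
  also have "\<dots> = mat_trace (P * P0)" by (rule mat_trace_mult_comm[OF P0 P])
  also have "\<dots> = mat_trace (B * H)" using \<open>P * P0 = P0\<close> by (simp add: P0_def)
  also have "\<dots> = mat_trace (H * B)" by (rule mat_trace_mult_comm[OF B H(1)])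
  also have "\<dots> = of_nat ?r" unfolding HB by (simp add: mat_trace_def)
  finally show ?thesis by (simp add: P_def)
qed

text \<open>\<open>Q\<close> projects orthogonally onto a subspace of the left kernel of
  \<open>A\<close>. Its trace is the dimension of that kernel, so the subspace is the whole kernel
  and the complementary projector has the column space of \<open>A\<close> as range.\<close>

lemma range_projector_eq:
  fixes A Q :: "real mat"
  assumes A: "A \<in> carrier_mat n m" and Q: "Q \<in> carrier_mat n n"
    and sym: "Q\<^sup>T = Q" and idem: "Q * Q = Q" and QA: "Q * A = 0\<^sub>m n m"
    and tr: "mat_trace Q = real n - real (mat_rank A)"
  shows "A * pseudoinverse A = 1\<^sub>m n - Q"
proof -
  define X where "X = pseudoinverse A"
  have X: "X \<in> carrier_mat m n" "A * X * A = A" "(A * X)\<^sup>T = A * X"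
    using is_pseudoinverse_pseudoinverse[of A] A by (auto simp: is_pseudoinverse_def X_def)
  define P where "P = A * X"
  have P: "P \<in> carrier_mat n n" "P\<^sup>T = P" using A X by (auto simp: P_def)
  have PP: "P * P = P"
    using assoc_mult_mat[of "A * X" n n A m X n] A X(1,2) by (simp add: P_def del: assoc_mult_mat)
  have QP: "Q * P = 0\<^sub>m n n"
  proof -
    have "Q * P = Q * A * X" unfolding P_def using A X(1) Q by (intro assoc_mult_mat[symmetric]) auto
    then show ?thesis using QA X by simp
  qed
  have PQ: "P * Q = 0\<^sub>m n n"
    using arg_cong[OF QP, of transpose_mat] P Q sym by (simp add: transpose_mult[of _ n n _ n])
  have trP: "mat_trace P = real (mat_rank A)"
    using vec_space.trace_idempotent_eq_rank[OF A X(1,2)] A by (simp add: P_def mat_rank_def)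
  define D where "D = 1\<^sub>m n - Q - P"
  have D: "D \<in> carrier_mat n n" using P Q by (auto simp: D_def)
  have "D\<^sup>T = D"
    using P Q sym transpose_minus[of "1\<^sub>m n - Q" n n P] transpose_minus[of "1\<^sub>m n" n n Q]
    by (simp add: D_def minus_carrier_mat)
  moreover have "D * D = D"
  proof -
    have "D * D = (1\<^sub>m n - Q) * D - P * D"
      using minus_mult_distrib_mat[of "1\<^sub>m n - Q" n n P D n] P Q D
      by (simp add: D_def[symmetric] minus_carrier_mat)
    also have "(1\<^sub>m n - Q) * D = D - Q * D"
      using minus_mult_distrib_mat[of "1\<^sub>m n" n n Q D n] Q D by simp
    also have "Q * D = 0\<^sub>m n n"
      using mult_minus_distrib_mat[of Q n n "1\<^sub>m n - Q" n P] mult_minus_distrib_mat[of Q n n "1\<^sub>m n" n Q]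
        P Q idem QP by (simp add: D_def minus_carrier_mat)
    also have "P * D = 0\<^sub>m n n"
      using mult_minus_distrib_mat[of P n n "1\<^sub>m n - Q" n P] mult_minus_distrib_mat[of P n n "1\<^sub>m n" n Q]
        P Q PP PQ by (auto simp: D_def minus_carrier_mat)
    finally show ?thesis using D by auto
  qed
  moreover have "mat_trace D = real n - mat_trace Q - mat_trace P"
    using P Q by (auto simp: D_def mat_trace_def sum_subtractf)
  \<comment> \<open>As \<open>D\<close> is symmetric and idempotent,
    \<open>D\<^sup>T * D = D\<close>; the two traces add up to \<open>n\<close>, so this has trace
    zero.\<close>
  ultimately have "D = 0\<^sub>m n n"
    using mat_eq_0_if_trace_eq_0[OF D] trP tr by simp
  have "P = 1\<^sub>m n - Q"
  proof (rule eq_matI)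
    fix i j assume "i < dim_row (1\<^sub>m n - Q)" "j < dim_col (1\<^sub>m n - Q)"
    then show "P $$ (i, j) = (1\<^sub>m n - Q) $$ (i, j)"
      using arg_cong[OF \<open>D = 0\<^sub>m n n\<close>, of "\<lambda>X. X $$ (i, j)"] P Q by (simp add: D_def)
  qed (use P Q in auto)
  then show ?thesis by (simp add: P_def X_def)
qed

section \<open>Leverages from the left kernel\<close>

lemma bij_betw_enumerate_set:
  assumes "finite A"
  shows "bij_betw (enumerate_set A) {..<card A} A"
  using someI_ex[OF ex_bij_betw_nat_finite[OF assms]]
  unfolding enumerate_set_def atLeast0LessThan .

lemma index_in:
  assumes "finite A" "x \<in> A"
  shows "index_in A x < card A" "enumerate_set A (index_in A x) = x"
proof -
  have "x \<in> enumerate_set A ` {..<card A}"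
    using bij_betw_enumerate_set[OF assms(1)] assms(2) by (simp add: bij_betw_def)
  then show "index_in A x < card A" "enumerate_set A (index_in A x) = x"
    unfolding index_in_def by (metis inv_into_into lessThan_iff, metis f_inv_into_f)
qed

text \<open>Carries the matrix criterion over to a kernel \<open>q\<close> indexed by edges, so that
  the chosen enumerations of edges and vertices disappear from the later computations.\<close>

lemma leverage_eq_one_minus:
  fixes q :: "'a set \<Rightarrow> 'a set \<Rightarrow> real"
  assumes fin: "finite (hedges F)" "finite (nonisolated F)"
    and sym: "\<And>e f. e \<in> hedges F \<Longrightarrow> f \<in> hedges F \<Longrightarrow> q e f = q f e"
    and idem: "\<And>e f. e \<in> hedges F \<Longrightarrow> f \<in> hedges F \<Longrightarrow> (\<Sum>g\<in>hedges F. q e g * q g f) = q e f"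
    and ann: "\<And>e v. e \<in> hedges F \<Longrightarrow> v \<in> nonisolated F \<Longrightarrow>
       (\<Sum>g\<in>hedges F. q e g * (if v \<in> g then 1 else 0)) = 0"
    and tr: "(\<Sum>e\<in>hedges F. q e e) = real (card (hedges F)) - real (mat_rank (incidence_mat F))"
    and e: "e \<in> hedges F"
  shows "leverage F e = 1 - q e e"
proof -
  let ?E = "hedges F" and ?V = "nonisolated F"
  define n m where "n = card ?E" and "m = card ?V"
  define g where "g = enumerate_set ?E"
  have bij: "bij_betw g {..<n} ?E"
    unfolding g_def n_def by (rule bij_betw_enumerate_set[OF fin(1)])
  have gE: "g i \<in> ?E" if "i < n" for i
    using bij that by (auto simp: bij_betw_def)
  have uV: "enumerate_set ?V j \<in> ?V" if "j < m" for j
    using bij_betw_enumerate_set[OF fin(2)] that by (auto simp: bij_betw_def m_def)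
  define A where "A = incidence_mat F"
  have A: "A \<in> carrier_mat n m" by (simp add: A_def incidence_mat_def n_def m_def)
  define Q where "Q = mat n n (\<lambda>(i, j). q (g i) (g j))"
  have Q: "Q \<in> carrier_mat n n" by (simp add: Q_def)
  have "Q\<^sup>T = Q"
    by (rule eq_matI) (auto simp: Q_def sym gE)
  moreover have "Q * Q = Q"
  proof (rule eq_matI)
    fix i j assume "i < dim_row Q" "j < dim_col Q"
    then have ij: "i < n" "j < n" using Q by auto
    then have "(Q * Q) $$ (i, j) = (\<Sum>k<n. q (g i) (g k) * q (g k) (g j))"
      by (simp add: Q_def scalar_prod_def atLeast0LessThan)
    also have "\<dots> = (\<Sum>f\<in>?E. q (g i) f * q f (g j))"
      by (rule sum.reindex_bij_betw[OF bij])
    finally show "(Q * Q) $$ (i, j) = Q $$ (i, j)"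
      using ij idem gE by (simp add: Q_def)
  qed (use Q in auto)
  moreover have "Q * A = 0\<^sub>m n m"
  proof (rule eq_matI)
    fix i j assume "i < dim_row (0\<^sub>m n m :: real mat)" "j < dim_col (0\<^sub>m n m :: real mat)"
    then have ij: "i < n" "j < m" by auto
    let ?v = "enumerate_set ?V j"
    have "(Q * A) $$ (i, j) = (\<Sum>k<n. q (g i) (g k) * (if ?v \<in> g k then 1 else 0))"
      using ij by (simp add: Q_def A_def incidence_mat_def n_def m_def g_def scalar_prod_def atLeast0LessThan)
    also have "\<dots> = (\<Sum>f\<in>?E. q (g i) f * (if ?v \<in> f then 1 else 0))"
      by (rule sum.reindex_bij_betw[OF bij])
    finally show "(Q * A) $$ (i, j) = 0\<^sub>m n m $$ (i, j)"
      using ij ann gE uV by simp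
  qed (use Q A in auto)
  moreover have "mat_trace Q = real n - real (mat_rank A)"
  proof -
    have "mat_trace Q = (\<Sum>i<n. q (g i) (g i))"
      by (simp add: mat_trace_def Q_def)
    also have "\<dots> = (\<Sum>f\<in>?E. q f f)"
      by (rule sum.reindex_bij_betw[OF bij])
    finally show ?thesis using tr by (simp add: n_def A_def)
  qed
  ultimately have "row_projector F = 1\<^sub>m n - Q"
    unfolding row_projector_def A_def[symmetric] by (intro range_projector_eq[OF A Q])
  then show ?thesis
    using index_in[OF fin(1) e] Q by (simp add: leverage_def Q_def n_def g_def)
qed

section \<open>The left kernel of a union of parallel classes\<close>

text \<open>
  The matrix of the orthogonal projector onto the functions that vanish outside the classes,
  are constant on each class and sum to zero.
\<close>
definition class_kernel :: "'b set set \<Rightarrow> nat \<Rightarrow> 'b \<Rightarrow> 'b \<Rightarrow> real" where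
  "class_kernel \<F> s e f =
     (if e \<in> \<Union>\<F> \<and> f \<in> \<Union>\<F>
      then ((if \<exists>c\<in>\<F>. e \<in> c \<and> f \<in> c then 1 else 0) - 1 / real (card \<F>)) / real s else 0)"

text \<open>Points and incidence are left out: the kernel computations need only disjoint classes of
  equal size. Incidence enters later through a weight function with sum one on each class.\<close>

locale uniform_classes =
  fixes \<F> :: "'b set set" and s :: nat
  assumes finite_classes: "finite \<F>" and nonempty_classes: "\<F> \<noteq> {}"
    and disjoint_classes: "disjoint \<F>"
    and card_class: "c \<in> \<F> \<Longrightarrow> card c = s" and size_pos: "0 < s"
begin

text \<open>Infinite sets have \<open>card\<close> zero, which \<open>0 < s\<close>
  excludes.\<close>

lemma finite_class: "c \<in> \<F> \<Longrightarrow> finite c"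
  using card_class size_pos card.infinite by fastforce

lemma class_eq: "c \<in> \<F> \<Longrightarrow> c' \<in> \<F> \<Longrightarrow> e \<in> c \<Longrightarrow> e \<in> c' \<Longrightarrow> c = c'"
  using disjoint_classes by (auto simp: disjoint_def)

lemma card_classes_pos: "0 < card \<F>"
  using finite_classes nonempty_classes by (simp add: card_gt_0_iff)

lemma card_Union_classes: "card (\<Union>\<F>) = card \<F> * s"
proof -
  have "card (\<Union>\<F>) = sum card \<F>"
    using disjoint_classes finite_class by (intro card_Union_disjoint) (auto simp: disjoint_def pairwise_def disjnt_def)
  then show ?thesis using card_class by simp
qed

lemma class_kernel_in:
  assumes "c \<in> \<F>" "c' \<in> \<F>" "e \<in> c" "f \<in> c'"
  shows "class_kernel \<F> s e f = ((if c = c' then 1 else 0) - 1 / real (card \<F>)) / real s"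
  using assms class_eq unfolding class_kernel_def by (smt (verit) Union_iff)

lemma sum_over_classes:
  fixes h :: "'b \<Rightarrow> real"
  assumes "finite E" "\<Union>\<F> \<subseteq> E" "\<And>f. f \<in> E - \<Union>\<F> \<Longrightarrow> h f = 0"
  shows "sum h E = (\<Sum>c\<in>\<F>. sum h c)"
proof -
  have "sum h E = sum h (\<Union>\<F>)"
    using assms by (intro sum.mono_neutral_right) auto
  also have "\<dots> = (\<Sum>c\<in>\<F>. sum h c)"
    using sum.Union_disjoint[of \<F> h] finite_class class_eq by (auto simp: comp_def)
  finally show ?thesis .
qed

lemma class_kernel_sym: "class_kernel \<F> s e f = class_kernel \<F> s f e"
  unfolding class_kernel_def by (simp add: conj_commute)

lemma class_kernel_idempotent:
  assumes "finite E" "\<Union>\<F> \<subseteq> E"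
  shows "(\<Sum>g\<in>E. class_kernel \<F> s e g * class_kernel \<F> s g f) = class_kernel \<F> s e f"
proof (cases "e \<in> \<Union>\<F> \<and> f \<in> \<Union>\<F>")
  case False
  then show ?thesis by (auto simp: class_kernel_def)
next
  case True
  then obtain c0 c1 where c: "c0 \<in> \<F>" "c1 \<in> \<F>" "e \<in> c0" "f \<in> c1" by blast
  define u where "u = 1 / real (card \<F>)"
  let ?\<delta> = "\<lambda>c c'. if c = c' then 1 else 0 :: real"
  have "(\<Sum>g\<in>E. class_kernel \<F> s e g * class_kernel \<F> s g f)
      = (\<Sum>c\<in>\<F>. \<Sum>g\<in>c. class_kernel \<F> s e g * class_kernel \<F> s g f)"
    using assms by (intro sum_over_classes) (auto simp: class_kernel_def)
  also have "\<dots> = (\<Sum>c\<in>\<F>. \<Sum>g\<in>c. ((?\<delta> c0 c - u) / real s) * ((?\<delta> c c1 - u) / real s))"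
    using c by (intro sum.cong refl) (simp add: class_kernel_in u_def)
  also have "\<dots> = (\<Sum>c\<in>\<F>. (?\<delta> c0 c * ?\<delta> c c1 - ?\<delta> c0 c * u - ?\<delta> c c1 * u + u\<^sup>2) / real s)"
  proof (intro sum.cong refl)
    fix c assume "c \<in> \<F>"
    \<comment> \<open>The summand is constant on a class, so the \<open>s\<close> equal terms cancel
      one of the two factors \<open>1 / s\<close>.\<close>
    have "real s * (((x - u) / real s) * ((y - u) / real s)) = (x * y - x * u - y * u + u\<^sup>2) / real s" for x y
      using size_pos by (simp add: field_simps power2_eq_square)
    then show "(\<Sum>g\<in>c. ((?\<delta> c0 c - u) / real s) * ((?\<delta> c c1 - u) / real s))
        = (?\<delta> c0 c * ?\<delta> c c1 - ?\<delta> c0 c * u - ?\<delta> c c1 * u + u\<^sup>2) / real s"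
      by (simp only: sum_constant card_class[OF \<open>c \<in> \<F>\<close>])
  qed
  \<comment> \<open>Each delta selects one class. Since \<open>u\<close> is the reciprocal of
    \<open>card \<F>\<close>, the last term equals \<open>u\<close> and cancels one of the two
    subtracted copies.\<close>
  also have "\<dots> = (?\<delta> c0 c1 - u - u + real (card \<F>) * u\<^sup>2) / real s"
  proof -
    have "(\<Sum>c\<in>\<F>. ?\<delta> c0 c * ?\<delta> c c1) = (\<Sum>c\<in>\<F>. if c0 = c then ?\<delta> c c1 else 0)"
      by (intro sum.cong) auto
    then have "(\<Sum>c\<in>\<F>. ?\<delta> c0 c * ?\<delta> c c1) = ?\<delta> c0 c1"
      using c finite_classes by simp
    moreover have "(\<Sum>c\<in>\<F>. ?\<delta> c0 c * u) = u" "(\<Sum>c\<in>\<F>. ?\<delta> c c1 * u) = u"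
      using c finite_classes by (simp_all add: sum_distrib_right[symmetric])
    ultimately show ?thesis
      by (simp only: sum_divide_distrib[symmetric] sum.distrib sum_subtractf sum_constant)
  qed
  also have "\<dots> = class_kernel \<F> s e f"
    using c card_classes_pos by (simp add: class_kernel_in u_def power2_eq_square)
  finally show ?thesis .
qed

text \<open>A kernel row is constant on each class, and each class has total weight one, so the sum
  reduces to a row sum of \<open>I - J/a\<close>, divided by \<open>s\<close>, which is zero. In the
  application \<open>w\<close> indicates the lines through a fixed point.\<close>

lemma class_kernel_annihilates:
  assumes "finite E" "\<Union>\<F> \<subseteq> E" and count: "\<And>c. c \<in> \<F> \<Longrightarrow> (\<Sum>g\<in>c. w g) = 1"
  shows "(\<Sum>g\<in>E. class_kernel \<F> s e g * w g) = 0"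
proof (cases "e \<in> \<Union>\<F>")
  case False
  then show ?thesis by (auto simp: class_kernel_def)
next
  case True
  then obtain c0 where c0: "c0 \<in> \<F>" "e \<in> c0" by blast
  let ?a = "real (card \<F>)" and ?s = "real s"
  have "(\<Sum>g\<in>E. class_kernel \<F> s e g * w g) = (\<Sum>c\<in>\<F>. \<Sum>g\<in>c. class_kernel \<F> s e g * w g)"
    using assms by (intro sum_over_classes) (auto simp: class_kernel_def)
  also have "\<dots> = (\<Sum>c\<in>\<F>. \<Sum>g\<in>c. ((if c0 = c then 1 else 0) - 1 / ?a) / ?s * w g)"
    using c0 by (intro sum.cong refl) (simp add: class_kernel_in)
  also have "\<dots> = (\<Sum>c\<in>\<F>. ((if c0 = c then 1 else 0) - 1 / ?a) / ?s)"
    by (intro sum.cong refl) (simp only: sum_distrib_left[symmetric] count mult_1_right)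
  also have "\<dots> = 0"
    using c0 finite_classes card_classes_pos by (auto simp: sum_divide_distrib[symmetric] sum_subtractf)
  finally show ?thesis .
qed

lemma class_kernel_diag: "e \<in> \<Union>\<F> \<Longrightarrow> class_kernel \<F> s e e = (1 - 1 / real (card \<F>)) / real s"
  using class_kernel_in by fastforce

lemma class_kernel_trace:
  assumes "finite E" "\<Union>\<F> \<subseteq> E"
  shows "(\<Sum>e\<in>E. class_kernel \<F> s e e) = real (card \<F>) - 1"
proof -
  have "(\<Sum>e\<in>E. class_kernel \<F> s e e) = (\<Sum>e\<in>\<Union>\<F>. class_kernel \<F> s e e)"
    using assms by (intro sum.mono_neutral_right) (auto simp: class_kernel_def)
  also have "\<dots> = (\<Sum>e\<in>\<Union>\<F>. (1 - 1 / real (card \<F>)) / real s)"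
    by (intro sum.cong refl class_kernel_diag)
  also have "\<dots> = real (card \<F>) - 1"
    using size_pos card_classes_pos by (simp add: card_Union_classes field_simps)
  finally show ?thesis .
qed

end

section \<open>Rank and leverages inside the affine plane\<close>

lemma partition_on_sum_indicator:
  assumes "partition_on P c" "finite c" "v \<in> P"
  shows "(\<Sum>g\<in>c. if v \<in> g then 1 else 0 :: real) = 1"
proof -
  obtain b where b: "b \<in> c" "v \<in> b" using assms by (auto simp: partition_on_def)
  have "v \<in> g \<longleftrightarrow> g = b" if "g \<in> c" for g
    using that b assms(1) by (auto simp: partition_on_def disjoint_def)
  then have "(\<Sum>g\<in>c. if v \<in> g then 1 else 0 :: real) = (\<Sum>g\<in>c. if g = b then 1 else 0)"
    by (intro sum.cong) auto
  then show ?thesis using b assms(2) by simp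
qed

theorem corollary6p1:
  fixes F :: "'a hypergraph" and P :: "'a set" and \<C> \<F> :: "'a set set set"
    and s d h :: nat
  assumes "finite_hypergraph F" and "hedges F \<noteq> {}"
    and "connected_hypergraph F" and "linear_hypergraph F" and "uniform s F"
    and "cograph (line_graph F)"
    and "R_inv s F = int d" and "0 < d" and "d \<le> s - 1"
    and "Comp s d"
    and "affine_plane s P \<C>"
    and "1 \<le> h" and "h \<le> d"
    and "hedges F \<subseteq> \<Union>\<C>"
    and "\<F> \<subseteq> \<C>" and "card \<F> = s + 1 - h" and "\<Union>\<F> \<subseteq> hedges F"
    and "card (hedges F \<inter> \<Union>(\<C> - \<F>)) = d - h"
  shows "(card (hverts F) = s ^ 2) \<and>
     (int (mat_rank (incidence_mat F))
           = 1 + (int s + 1 - int h) * (int s - 1) + (int d - int h)) \<and>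
     (C_inv F = int h * int s - int d) \<and>
     ((int s + 1) * int (card (hverts F)) - int s * int (card (hedges F))
           = int s * ((int s + 1) * int h - int d)) \<and>
     (\<forall>e \<in> hedges F \<inter> \<Union>(\<C> - \<F>). leverage F e = 1) \<and>
     (\<forall>e \<in> \<Union>\<F>. leverage F e
           = 1 - (real s - real h) / (real s * (real s + 1 - real h)))"
proof -
  let ?E = "hedges F" and ?a = "card \<F>" and ?r = "mat_rank (incidence_mat F)"
  let ?K = "class_kernel \<F> s"
  \<comment> \<open>From \<open>0 < d\<close> and \<open>d \<le> s - 1\<close> it follows that
    \<open>s\<close> is at least 2, so the truncated subtractions are harmless and
    \<open>s + 1 - h\<close> is at least 2.\<close>
  have hs: "h \<le> s" "0 < s" and a_pos: "0 < ?a"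
    using assms by auto
  have net: "card P = s\<^sup>2" "finite \<C>" "card \<C> = s + 1" "disjoint \<C>"
    "\<And>c. c \<in> \<C> \<Longrightarrow> card c = s \<and> partition_on P c"
    using \<open>affine_plane s P \<C>\<close> by (auto simp: affine_plane_def net_def)
  interpret uniform_classes \<F> s
  proof
    show "finite \<F>" using assms net finite_subset by blast
    show "\<F> \<noteq> {}" using a_pos by auto
    show "disjoint \<F>" using assms net by (meson disjoint_def subsetD)
  qed (use assms net hs in auto)
  have finE: "finite ?E"
    using assms(1) by (intro finite_subset[of ?E "Pow (hverts F)"]) (auto simp: finite_hypergraph_def)
  \<comment> \<open>A single full class already covers \<open>P\<close>, so every point is
    nonisolated; connectedness rules out further vertices.\<close>
  have V: "nonisolated F = P" "hverts F = P"
  proof -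
    have "e \<subseteq> P" if "e \<in> ?E" for e
      using that assms(14) net(5) by (fastforce simp: partition_on_def)
    then have "nonisolated F \<subseteq> P" by (auto simp: nonisolated_def)
    moreover obtain c where c: "c \<in> \<F>" using nonempty_classes by blast
    then have "P = \<Union>c" using net(5) assms(15) by (auto simp: partition_on_def)
    then have "P \<subseteq> nonisolated F"
      using c assms(1,17) by (fastforce simp: nonisolated_def finite_hypergraph_def)
    ultimately show "nonisolated F = P" by blast
    then show "hverts F = P" using assms(3) by (simp add: connected_hypergraph_def)
  qed
  have finP: "finite P" using net(1) hs card_ge_0_finite[of P] by simp
  have cardE: "card ?E = ?a * s + (d - h)"
  proof -
    have "?E = \<Union>\<F> \<union> (?E \<inter> \<Union>(\<C> - \<F>))" using assms(14,17) by blast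
    moreover have "\<Union>\<F> \<inter> (?E \<inter> \<Union>(\<C> - \<F>)) = {}"
      using net(4) assms(15) by (fastforce simp: disjoint_def)
    ultimately have "card ?E = card (\<Union>\<F>) + card (?E \<inter> \<Union>(\<C> - \<F>))"
      using finE by (metis card_Un_disjoint finite_Un)
    then show ?thesis using assms(18) card_Union_classes by simp
  qed
  have a_int: "int ?a = int s + 1 - int h" and dh: "int (d - h) = int d - int h"
    using assms(13,16) hs by auto
  have cardE_int: "int (card ?E) = (int s + 1 - int h) * int s + (int d - int h)"
    unfolding cardE by (simp add: a_int dh)
  \<comment> \<open>The value of \<open>R_inv\<close> determines the rank once the edges are
    counted: the factor \<open>s + 1\<close> divides out.\<close>
  have rank: "int ?r = 1 + (int s + 1 - int h) * (int s - 1) + (int d - int h)"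
  proof -
    have "(int s + 1) * int ?r = int s * int (card ?E) + int d"
      using assms(7) by (simp add: R_inv_def)
    also have "\<dots> = (int s + 1) * (1 + (int s + 1 - int h) * (int s - 1) + (int d - int h))"
      unfolding cardE_int by (simp add: algebra_simps)
    finally show ?thesis by (simp only: mult_cancel_left) auto
  qed
  have lev: "leverage F e = 1 - ?K e e" if e: "e \<in> ?E" for e
  proof (rule leverage_eq_one_minus[where q = ?K])
    show "(\<Sum>g\<in>?E. ?K e g * (if v \<in> g then 1 else 0)) = 0" if "v \<in> nonisolated F" for e v
      using that V net(5) assms(15,17) finE finite_class
      by (intro class_kernel_annihilates partition_on_sum_indicator[of P]) auto
    \<comment> \<open>The left kernel has dimension \<open>card \<F> - 1\<close>, exactly the trace
      of the explicit kernel, so no further relations among the rows exist.\<close>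
    have "real (card ?E) - real ?r = real_of_int (int (card ?E) - int ?r)" by simp
    also have "\<dots> = real_of_int (int ?a - 1)"
      unfolding rank cardE_int a_int by (simp add: algebra_simps)
    finally show "(\<Sum>e\<in>?E. ?K e e) = real (card ?E) - real ?r"
      using class_kernel_trace[OF finE] assms(17) by simp
  qed (use finE finP V assms(17) e class_kernel_sym class_kernel_idempotent in auto)
  have full: "\<forall>e\<in>\<Union>\<F>. leverage F e = 1 - (real s - real h) / (real s * (real s + 1 - real h))"
  proof
    fix e assume e: "e \<in> \<Union>\<F>"
    have a: "real ?a = real s + 1 - real h" using assms(16) hs by simp
    \<comment> \<open>The diagonal entry is \<open>(1 - 1/a) / s\<close> with
      \<open>a = s + 1 - h\<close>, hence \<open>a - 1 = s - h\<close>.\<close>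
    have "?K e e = (real ?a - 1) / (real s * real ?a)"
      using class_kernel_diag[OF e] a_pos hs by (simp add: field_simps)
    also have "\<dots> = (real s - real h) / (real s * (real s + 1 - real h))"
      unfolding a by simp
    finally show "leverage F e = 1 - (real s - real h) / (real s * (real s + 1 - real h))"
      using lev e assms(17) by auto
  qed
  have partial: "\<forall>e \<in> ?E \<inter> \<Union>(\<C> - \<F>). leverage F e = 1"
  proof
    fix e assume e: "e \<in> ?E \<inter> \<Union>(\<C> - \<F>)"
    \<comment> \<open>Distinct parallel classes share no line, so a partial-direction line lies
      where the kernel vanishes.\<close>
    then have "e \<notin> \<Union>\<F>"
      using net(4) assms(15) by (fastforce simp: disjoint_def)
    then have "?K e e = 0" by (simp add: class_kernel_def)
    then show "leverage F e = 1" using lev e by auto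
  qed
  show ?thesis
    using V net(1) rank full partial
    by (auto simp: C_inv_def cardE_int algebra_simps power2_eq_square)
qed

end
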